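(* No nonempty closed subalgebra of $(\mathbb N^*,+,\cdot)$ satisfies the left distributivity law. That is, if $A\subseteq\mathbb N^*$ is nonempty, closed in $\mathbb N^*$, and closed under the operations $+$ and $\cdot$, then there are $u,v,w\in A$ with $u\cdot(v+w)\neq u\cdot v+u\cdot w$.
   Context: Let $\beta\mathbb N$ be the set of all ultrafilters over the set $\mathbb N$ of natural numbers, with the topology whose basic (clopen) sets are $O_S=\{u\in\beta\mathbb N: S\in u\}$ for $S\subseteq\mathbb N$. Elements of $\mathbb N$ are identified with principal ultrafilters, and $\mathbb N^*=\beta\mathbb N\setminus\mathbb N$ is the set of non-principal ultrafilters with the subspace topology. The usual addition and multiplication of $\mathbb N$ are extended to $\beta\mathbb N$ by $$u+v=\{S\subseteq\mathbb N:\{a\in\mathbb N:\{b\in\mathbb N: a+b\in S\}\in u\}\in v\},$$ $$u\cdot v=\{S\subseteq\mathbb N:\{a\in\mathbb N:\{b\in\mathbb N: ab\in S\}\in u\}\in v\}.$$ With these operations, for each fixed first argument $u$ the maps $v\mapsto u+v$ and $v\mapsto u\cdot v$ are continuous, and $\mathbb N^*$ is closed under both operations; $(\mathbb N^*,+,\cdot)$ denotes $\mathbb N^*$ with the restricted operations. *)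

theory Defs
  imports "HOL-Analysis.Abstract_Topology"
begin

definition ultrafilter_on_nat :: "nat set set \<Rightarrow> bool" where
  "ultrafilter_on_nat u \<longleftrightarrow>
     UNIV \<in> u \<and> {} \<notin> u \<and>
     (\<forall>S T. S \<in> u \<longrightarrow> S \<subseteq> T \<longrightarrow> T \<in> u) \<and>
     (\<forall>S T. S \<in> u \<longrightarrow> T \<in> u \<longrightarrow> S \<inter> T \<in> u) \<and>
     (\<forall>S. S \<in> u \<or> - S \<in> u)"

definition betaN :: "nat set set set" where
  "betaN = {u. ultrafilter_on_nat u}"

definition basic_open :: "nat set \<Rightarrow> nat set set set" where
  "basic_open S = {u \<in> betaN. S \<in> u}"

definition betaN_topology :: "nat set set topology" where
  "betaN_topology = topology_generated_by (range basic_open)"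

definition principal_uf :: "nat \<Rightarrow> nat set set" where
  "principal_uf n = {S. n \<in> S}"

text \<open>
  The natural numbers here include 0.  This does not affect the structure on \<open>Nstar\<close>:
  a non-principal ultrafilter does not contain \<open>{0}\<close>.
\<close>

definition Nstar :: "nat set set set" where
  "Nstar = betaN - range principal_uf"

definition Nstar_topology :: "nat set set topology" where
  "Nstar_topology = subtopology betaN_topology Nstar"

text \<open>
  The outer set is measured by the second argument and the inner one by the first, so the maps
  \<open>\<lambda>v. u \<oplus>\<^sub>\<beta> v\<close> and \<open>\<lambda>v. u \<odot>\<^sub>\<beta> v\<close> are the continuous ones; part of the literature uses
  the opposite convention.
\<close>

definition uf_add :: "nat set set \<Rightarrow> nat set set \<Rightarrow> nat set set" (infixl "\<oplus>\<^sub>\<beta>" 65) where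
  "u \<oplus>\<^sub>\<beta> v = {S. {a. {b. a + b \<in> S} \<in> u} \<in> v}"

definition uf_mult :: "nat set set \<Rightarrow> nat set set \<Rightarrow> nat set set" (infixl "\<odot>\<^sub>\<beta>" 70) where
  "u \<odot>\<^sub>\<beta> v = {S. {a. {b. a * b \<in> S} \<in> u} \<in> v}"

lemma ultrafilterD:
  assumes "ultrafilter_on_nat u"
  shows "UNIV \<in> u" "{} \<notin> u"
    and "S \<in> u \<Longrightarrow> S \<subseteq> T \<Longrightarrow> T \<in> u"
    and "S \<inter> T \<in> u \<longleftrightarrow> S \<in> u \<and> T \<in> u"
    and "- S \<in> u \<longleftrightarrow> S \<notin> u"
proof -
  show 1: "UNIV \<in> u" "{} \<notin> u" and 2: "S \<in> u \<Longrightarrow> S \<subseteq> T \<Longrightarrow> T \<in> u" for S T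
    using assms unfolding ultrafilter_on_nat_def by blast+
  have 3: "S \<in> u \<Longrightarrow> T \<in> u \<Longrightarrow> S \<inter> T \<in> u" for S T
    using assms unfolding ultrafilter_on_nat_def by blast
  show "S \<inter> T \<in> u \<longleftrightarrow> S \<in> u \<and> T \<in> u"
    using 2[of "S \<inter> T"] 3 by blast
  show "- S \<in> u \<longleftrightarrow> S \<notin> u"
    using 1(2) 3[of S "- S"] assms unfolding ultrafilter_on_nat_def by auto
qed

lemma ultrafilter_extend:
  fixes f :: "nat \<Rightarrow> nat \<Rightarrow> nat"
  assumes u: "ultrafilter_on_nat u" and v: "ultrafilter_on_nat v"
  shows "ultrafilter_on_nat {S. {a. {b. f a b \<in> S} \<in> u} \<in> v}"
proof -
  have int: "{b. f a b \<in> S \<inter> T} = {b. f a b \<in> S} \<inter> {b. f a b \<in> T}"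
    and compl: "{b. f a b \<in> - S} = - {b. f a b \<in> S}" for a S T
    by auto
  have int': "{a. {b. f a b \<in> S \<inter> T} \<in> u} = {a. {b. f a b \<in> S} \<in> u} \<inter> {a. {b. f a b \<in> T} \<in> u}"
    and compl': "{a. {b. f a b \<in> - S} \<in> u} = - {a. {b. f a b \<in> S} \<in> u}" for S T
    unfolding int compl by (auto simp: ultrafilterD(4,5)[OF u])
  have up: "{a. {b. f a b \<in> T} \<in> u} \<in> v"
    if "{a. {b. f a b \<in> S} \<in> u} \<in> v" "S \<subseteq> T" for S T
    by (rule ultrafilterD(3)[OF v that(1)], safe, erule ultrafilterD(3)[OF u]) (use that in auto)
  show ?thesis
    unfolding ultrafilter_on_nat_def mem_Collect_eq int' compl'
    using up by (auto simp: ultrafilterD(1,2)[OF u] ultrafilterD(1,2,4,5)[OF v])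
qed

lemma betaN_closed:
  assumes "u \<in> betaN" "v \<in> betaN"
  shows "u \<oplus>\<^sub>\<beta> v \<in> betaN" "u \<odot>\<^sub>\<beta> v \<in> betaN"
  using assms ultrafilter_extend[of u v] by (auto simp: betaN_def uf_add_def uf_mult_def)

lemma principal_uf_in_betaN: "principal_uf n \<in> betaN"
  by (auto simp: betaN_def ultrafilter_on_nat_def principal_uf_def)

lemma principal_uf_add: "principal_uf m \<oplus>\<^sub>\<beta> principal_uf n = principal_uf (m + n)"
  by (simp add: uf_add_def principal_uf_def add.commute)

lemma principal_uf_mult: "principal_uf m \<odot>\<^sub>\<beta> principal_uf n = principal_uf (m * n)"
  by (simp add: uf_mult_def principal_uf_def mult.commute)

lemma Nstar_iff: "u \<in> Nstar \<longleftrightarrow> u \<in> betaN \<and> (\<forall>n. {n} \<notin> u)"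
proof -
  have "{n} \<in> u \<longleftrightarrow> u = principal_uf n" if "u \<in> betaN" for n
  proof
    assume n: "{n} \<in> u"
    have uf: "ultrafilter_on_nat u" using that by (simp add: betaN_def)
    have "n \<in> S" if "S \<in> u" for S
    proof (rule ccontr)
      assume "n \<notin> S"
      then have "{n} \<inter> S = {}" by auto
      then show False
        using ultrafilterD(2,4)[OF uf] n that by metis
    qed
    moreover have "S \<in> u" if "n \<in> S" for S
      using ultrafilterD(3)[OF uf n] that by auto
    ultimately show "u = principal_uf n"
      by (auto simp: principal_uf_def)
  qed (simp add: principal_uf_def)
  then show ?thesis by (auto simp: Nstar_def)
qed

lemma Nstar_closed:
  assumes "u \<in> Nstar" "v \<in> Nstar"
  shows "u \<oplus>\<^sub>\<beta> v \<in> Nstar" "u \<odot>\<^sub>\<beta> v \<in> Nstar"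
proof -
  have uf: "ultrafilter_on_nat u" "ultrafilter_on_nat v"
    and np: "\<And>n. {n} \<notin> u" "\<And>n. {n} \<notin> v"
    using assms by (auto simp: Nstar_iff betaN_def)
  have small: "X \<notin> u" if "X \<subseteq> {k}" for X k
    using ultrafilterD(3)[OF uf(1) _ that] np by auto
  have "{b. a + b = n} \<notin> u" for a n
    by (rule small[of _ "n - a"]) auto
  then have 1: "{n} \<notin> u \<oplus>\<^sub>\<beta> v" for n
    using ultrafilterD(2)[OF uf(2)] by (simp add: uf_add_def)
  have "{b. a * b = n} \<notin> u" if "a \<noteq> 0" for a n
    by (rule small[of _ "n div a"]) (use that in auto)
  then have "{a. {b. a * b = n} \<in> u} \<subseteq> {0}" for n
    by auto
  then have 2: "{n} \<notin> u \<odot>\<^sub>\<beta> v" for n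
    using ultrafilterD(3)[OF uf(2), of _ "{0}"] np(2)[of 0] unfolding uf_mult_def by fastforce
  show "u \<oplus>\<^sub>\<beta> v \<in> Nstar" "u \<odot>\<^sub>\<beta> v \<in> Nstar"
    using 1 2 betaN_closed[of u v] assms by (auto simp: Nstar_iff)
qed

lemma basic_open_Int: "basic_open S \<inter> basic_open T = basic_open (S \<inter> T)"
  by (auto simp: basic_open_def betaN_def ultrafilterD(4))

lemma basic_open_Compl: "betaN - basic_open S = basic_open (- S)"
  by (auto simp: basic_open_def betaN_def ultrafilterD(5))

lemma topspace_betaN: "topspace betaN_topology = betaN"
  by (auto simp: betaN_topology_def basic_open_def betaN_def dest: ultrafilterD(1))

lemma topspace_Nstar: "topspace Nstar_topology = Nstar"
  by (auto simp: Nstar_topology_def topspace_betaN Nstar_def)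

lemma continuous_uf_ops:
  assumes "u \<in> betaN"
  shows "continuous_map betaN_topology betaN_topology (\<lambda>v. u \<oplus>\<^sub>\<beta> v)"
    and "continuous_map betaN_topology betaN_topology (\<lambda>v. u \<odot>\<^sub>\<beta> v)"
proof -
  have *: "continuous_map betaN_topology betaN_topology f"
    if "\<And>v. v \<in> betaN \<Longrightarrow> f v \<in> betaN" "\<And>S v. S \<in> f v \<longleftrightarrow> g S \<in> v" for f g
  proof -
    have "f -` basic_open S \<inter> betaN = basic_open (g S)" for S
      using that by (auto simp: basic_open_def)
    moreover have "openin betaN_topology (basic_open (g S))" for S
      unfolding betaN_topology_def by (intro topology_generated_by_Basis) auto
    moreover have "f ` betaN \<subseteq> \<Union> (range basic_open)"
      using that(1) topspace_betaN by (auto simp: betaN_topology_def)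
    ultimately show ?thesis
      by (subst (2) betaN_topology_def, subst continuous_on_generated_topo_iff)
        (auto simp: topspace_betaN)
  qed
  show "continuous_map betaN_topology betaN_topology (\<lambda>v. u \<oplus>\<^sub>\<beta> v)"
    by (rule *[where g = "\<lambda>S. {a. {b. a + b \<in> S} \<in> u}"])
      (use assms betaN_closed in \<open>auto simp: uf_add_def\<close>)
  show "continuous_map betaN_topology betaN_topology (\<lambda>v. u \<odot>\<^sub>\<beta> v)"
    by (rule *[where g = "\<lambda>S. {a. {b. a * b \<in> S} \<in> u}"])
      (use assms betaN_closed in \<open>auto simp: uf_mult_def\<close>)
qed

end

theory Submission
  imports Defs "HOL-Analysis.Analysis" "HOL-Library.Real_Mod"
begin

text \<open>
  A left distributive closed subalgebra \<open>A\<close> would contain a point that is idempotent for both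
  operations, and \<open>Nstar\<close> has no such point.

  For the first claim, compactness and Zorn's lemma give a minimal nonempty closed subalgebra
  \<open>M \<subseteq> A\<close>, and the Ellis argument gives \<open>u \<in> M\<close> with \<open>u + u = u\<close>. By left distributivity
  the continuous map \<open>v \<mapsto> u v\<close> is an additive homomorphism. Hence \<open>u M\<close> is again a closed
  subalgebra, so \<open>u M = M\<close>, and the fibre \<open>{v \<in> M. u v = u}\<close> is nonempty. The fibre is closed
  under \<open>+\<close> because \<open>u + u = u\<close>, and under multiplication by associativity, so by minimality it
  is all of \<open>M\<close>; in particular \<open>u u = u\<close>. Both this and the Ellis argument are instances of
  \<open>minimal_closed_imp_fixpoint\<close>.

  For the second claim (\<open>add_idempotent_not_mult_idempotent\<close>), let
  \<open>\<chi> n = exp (2 \<pi> i log\<^sub>2 n)\<close>, a multiplicative map into the unit circle that takes the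
  value 1 on the positive integers exactly at the powers of 2. Its limit along a multiplicative
  idempotent is an idempotent of the circle, so it is 1. An additive idempotent contains all
  the sets \<open>2\<^sup>m \<nat>\<close> and does not contain the set of powers of 2. Compare now the
  power of 2 that divides \<open>x\<close> with the distance of \<open>\<chi> x\<close> from 1, for \<open>b\<close> chosen much later than
  \<open>a\<close>. For \<open>x = a b\<close>, the distance stays near \<open>\<bar>\<chi> a - 1\<bar> > 0\<close> while \<open>x\<close> is divisible by as
  large a power of 2 as desired. For \<open>x = a + b\<close>, the distance is as small as desired while the
  power of 2 that divides \<open>x\<close> is bounded in terms of \<open>a\<close>. So the set of \<open>x\<close> with
  \<open>1 < 2\<^sup>m \<bar>\<chi> x - 1\<bar>\<close> for some \<open>2\<^sup>m\<close> dividing \<open>x\<close> belongs to \<open>u u\<close> but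
  not to \<open>u + u\<close>.
\<close>

section \<open>Ultrafilters on the natural numbers as filters\<close>

text \<open>
  Viewing an ultrafilter as a filter makes \<open>eventually\<close> and limits available: membership in a
  sum or a product becomes a pair of nested \<open>eventually\<close> quantifiers.
\<close>

definition uf_filter :: "nat set set \<Rightarrow> nat filter" where
  "uf_filter u = Abs_filter (\<lambda>P. {n. P n} \<in> u)"

lemma eventually_uf_filter:
  assumes "u \<in> betaN"
  shows "eventually P (uf_filter u) \<longleftrightarrow> {n. P n} \<in> u"
proof -
  have uf: "ultrafilter_on_nat u"
    using assms by (simp add: betaN_def)
  have "is_filter (\<lambda>P. {n. P n} \<in> u)"
  proof
    show "{n. True} \<in> u"
      using ultrafilterD(1)[OF uf] by simp
    show "{n. P n \<and> Q n} \<in> u" if "{n. P n} \<in> u" "{n. Q n} \<in> u" for P Q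
      using that ultrafilterD(4)[OF uf, of "{n. P n}" "{n. Q n}"] by (simp add: Collect_conj_eq)
    show "{n. Q n} \<in> u" if "\<forall>n. P n \<longrightarrow> Q n" "{n. P n} \<in> u" for P Q
      using ultrafilterD(3)[OF uf that(2)] that(1) by blast
  qed
  then show ?thesis
    by (simp add: uf_filter_def eventually_Abs_filter)
qed

lemma uf_filter_neq_bot:
  assumes "u \<in> betaN"
  shows "uf_filter u \<noteq> bot"
  using assms by (auto simp: trivial_limit_def eventually_uf_filter betaN_def ultrafilterD(2))

lemma eventually_uf_filter_not:
  assumes "u \<in> betaN"
  shows "eventually (\<lambda>n. \<not> P n) (uf_filter u) \<longleftrightarrow> \<not> eventually P (uf_filter u)"
  using assms ultrafilterD(5)[of u "{n. P n}"]
  by (simp add: eventually_uf_filter betaN_def Collect_neg_eq)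

lemma eventually_uf_filter_add:
  assumes "u \<in> betaN" "v \<in> betaN"
  shows "eventually P (uf_filter (u \<oplus>\<^sub>\<beta> v)) \<longleftrightarrow>
    (\<forall>\<^sub>F a in uf_filter v. \<forall>\<^sub>F b in uf_filter u. P (a + b))"
  by (simp add: eventually_uf_filter assms betaN_closed) (simp add: uf_add_def)

lemma eventually_uf_filter_mult:
  assumes "u \<in> betaN" "v \<in> betaN"
  shows "eventually P (uf_filter (u \<odot>\<^sub>\<beta> v)) \<longleftrightarrow>
    (\<forall>\<^sub>F a in uf_filter v. \<forall>\<^sub>F b in uf_filter u. P (a * b))"
  by (simp add: eventually_uf_filter assms betaN_closed) (simp add: uf_mult_def)

lemma uf_filter_le_sequentially:
  assumes "u \<in> Nstar"
  shows "uf_filter u \<le> sequentially"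
  unfolding le_sequentially
proof
  fix N
  have u: "u \<in> betaN" and np: "\<And>n. {n} \<notin> u"
    using assms by (auto simp: Nstar_iff)
  have "\<forall>k\<in>{..<N}. \<forall>\<^sub>F n in uf_filter u. n \<noteq> k"
    using np by (simp add: eventually_uf_filter_not[OF u] eventually_uf_filter[OF u])
  then have "\<forall>\<^sub>F n in uf_filter u. \<forall>k\<in>{..<N}. n \<noteq> k"
    by (intro eventually_ball_finite) auto
  then show "\<forall>\<^sub>F n in uf_filter u. N \<le> n"
    by eventually_elim (metis lessThan_iff not_le_imp_less)
qed

text \<open>
  Compactness gives a cluster point, and an ultrafilter converges to each of its cluster points.
\<close>

lemma uf_filter_convergent:
  fixes f :: "nat \<Rightarrow> 'a :: topological_space"
  assumes u: "u \<in> betaN" and K: "compact K" "range f \<subseteq> K"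
  obtains l where "l \<in> K" "(f \<longlongrightarrow> l) (uf_filter u)"
proof -
  let ?F = "filtermap f (uf_filter u)"
  have "?F \<noteq> bot" "eventually (\<lambda>x. x \<in> K) ?F"
    using uf_filter_neq_bot[OF u] K(2)
    by (auto simp: filtermap_bot_iff eventually_filtermap image_subset_iff)
  then obtain l where l: "l \<in> K" "inf (nhds l) ?F \<noteq> bot"
    using K(1) unfolding compact_filter by blast
  have "(f \<longlongrightarrow> l) (uf_filter u)"
  proof (rule topological_tendstoI, rule ccontr)
    fix U assume U: "open U" "l \<in> U" "\<not> (\<forall>\<^sub>F n in uf_filter u. f n \<in> U)"
    then have "\<forall>\<^sub>F y in ?F. y \<notin> U"
      by (simp add: eventually_filtermap eventually_uf_filter_not[OF u])
    moreover have "\<forall>\<^sub>F y in nhds l. y \<in> U"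
      using U by (simp add: eventually_nhds_in_open)
    ultimately have "eventually (\<lambda>_. False) (inf (nhds l) ?F)"
      unfolding eventually_inf by blast
    with l(2) show False
      by (simp add: trivial_limit_def)
  qed
  with l(1) show thesis by (rule that)
qed

section \<open>No point is idempotent for both operations\<close>

text \<open>
  The residue modulo \<open>n\<close> is constant along an ultrafilter, and idempotency forces the constant
  to satisfy \<open>r + r \<equiv> r\<close>.
\<close>

lemma add_idempotent_dvd:
  assumes u: "u \<in> betaN" and add: "u \<oplus>\<^sub>\<beta> u = u" and n: "n > 0"
  shows "\<forall>\<^sub>F a in uf_filter u. n dvd a"
proof -
  have "\<exists>r<n. \<forall>\<^sub>F a in uf_filter u. a mod n = r"
  proof (rule ccontr)
    assume "\<not> ?thesis"
    then have "\<forall>r\<in>{..<n}. \<forall>\<^sub>F a in uf_filter u. a mod n \<noteq> r"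
      by (auto simp: eventually_uf_filter_not[OF u])
    then have "\<forall>\<^sub>F a in uf_filter u. \<forall>r\<in>{..<n}. a mod n \<noteq> r"
      by (intro eventually_ball_finite) auto
    then have "eventually (\<lambda>_. False) (uf_filter u)"
      by eventually_elim (use n in auto)
    then show False
      using uf_filter_neq_bot[OF u] by (simp add: trivial_limit_def)
  qed
  then obtain r where r: "r < n" "\<forall>\<^sub>F a in uf_filter u. a mod n = r"
    by blast
  have "\<forall>\<^sub>F a in uf_filter u. \<forall>\<^sub>F b in uf_filter u. (a + b) mod n = r"
    using r(2) by (subst (asm) add[symmetric]) (simp only: eventually_uf_filter_add[OF u u])
  then have "\<forall>\<^sub>F a in uf_filter u. \<forall>\<^sub>F b in uf_filter u. r = 0"
    using r(2)
  proof eventually_elim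
    case (elim a)
    note a = elim(2)
    show ?case
      using elim(1) r(2)
    proof eventually_elim
      case (elim b)
      with a have "(r + r) mod n = r"
        by (metis mod_add_eq)
      then show "r = 0"
        using r(1) by (cases "r + r < n") (auto simp: le_mod_geq)
    qed
  qed
  then have "r = 0"
    by (simp add: uf_filter_neq_bot[OF u])
  with r(2) show ?thesis
    by (simp add: dvd_eq_mod_eq_0)
qed

text \<open>
  A sum of two distinct powers of 2 is not a power of 2.
\<close>

lemma add_idempotent_not_power_of_2:
  assumes u: "u \<in> Nstar" and add: "u \<oplus>\<^sub>\<beta> u = u"
  shows "\<forall>\<^sub>F a in uf_filter u. a \<notin> range ((^) 2)"
proof (rule ccontr)
  have u': "u \<in> betaN" using u by (simp add: Nstar_iff)
  assume "\<not> ?thesis"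
  then have pow: "\<forall>\<^sub>F a in uf_filter u. a \<in> range ((^) 2)"
    by (simp add: eventually_uf_filter_not[OF u'])
  then have "\<forall>\<^sub>F a in uf_filter u. \<forall>\<^sub>F b in uf_filter u. a + b \<in> range ((^) 2)"
    by (subst (asm) add[symmetric]) (simp only: eventually_uf_filter_add[OF u' u'])
  with pow have "\<forall>\<^sub>F a in uf_filter u. \<forall>\<^sub>F b in uf_filter u. False"
  proof eventually_elim
    case (elim a)
    note a = elim(1)
    have "\<forall>\<^sub>F b in uf_filter u. b > a"
      using uf_filter_le_sequentially[OF u] eventually_gt_at_top filter_leD by blast
    with elim(2) pow show ?case
    proof eventually_elim
      case (elim b)
      then obtain i j k :: nat where ijk: "a = 2 ^ i" "b = 2 ^ j" "a + b = 2 ^ k"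
        using a by blast
      have "(2::nat) ^ j < 2 ^ k"
        using ijk by (metis less_add_same_cancel2 zero_less_numeral zero_less_power)
      then have "Suc j \<le> k" by simp
      then have "(2::nat) ^ Suc j \<le> 2 ^ k"
        by (rule power_increasing) simp
      then show False
        using ijk elim by simp
    qed
  qed
  then show False
    by (simp add: uf_filter_neq_bot[OF u'])
qed

text \<open>
  The restriction to the positive integers of the character \<open>x \<mapsto> x\<^bsup>it\<^esup>\<close> with
  \<open>t = 2 \<pi> / ln 2\<close>, which records the position of \<open>x\<close> between consecutive powers of 2. It turns
  multiplication into rotation of the circle, while adding a fixed number to a large \<open>x\<close> hardly
  changes it.
\<close>

definition log_phase :: "nat \<Rightarrow> complex" where
  "log_phase n = cis (2 * pi * log 2 (real n))"

lemma norm_log_phase: "norm (log_phase n) = 1"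
  by (simp add: log_phase_def)

lemma log_phase_mult:
  assumes "a > 0" "b > 0"
  shows "log_phase (a * b) = log_phase a * log_phase b"
  using assms by (simp add: log_phase_def cis_mult log_mult distrib_left)

lemma log_phase_eq_1_iff:
  assumes "a > 0"
  shows "log_phase a = 1 \<longleftrightarrow> a \<in> range ((^) 2)"
proof
  assume "log_phase a = 1"
  then obtain n :: int where n: "log 2 (real a) = of_int n"
    by (auto simp: log_phase_def cis_eq_1_iff)
  have "n \<ge> 0"
    using n assms zero_le_log_cancel_iff[of 2 "real a"] by simp
  then obtain k where k: "n = int k"
    using nonneg_int_cases by blast
  have "real a = 2 powr real k"
    using n assms powr_log_cancel[of 2 "real a"] by (simp add: k)
  then have "real a = real (2 ^ k)"
    by (simp add: powr_realpow)
  then show "a \<in> range ((^) 2)"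
    by (metis of_nat_eq_iff rangeI)
next
  assume "a \<in> range ((^) 2)"
  then obtain k where "a = 2 ^ k" by blast
  then have "log 2 (real a) = real k"
    by (simp add: log_nat_power)
  then show "log_phase a = 1"
    using cis_eq_1_iff[of "2 * pi * log 2 (real a)"]
    by (metis log_phase_def mult.commute of_int_of_nat_eq)
qed

lemma log_phase_add_quotient:
  "(\<lambda>b. log_phase (a + b) / log_phase b) \<longlonglongrightarrow> 1"
proof -
  have "(\<lambda>b. real a / real b) \<longlonglongrightarrow> 0"
    by (intro tendsto_divide_0[OF tendsto_const]) (simp add: filterlim_at_infinity_conv_norm_at_top
        filterlim_real_sequentially)
  then have "(\<lambda>b. cis (2 * pi * log 2 (1 + real a / real b))) \<longlonglongrightarrow> cis (2 * pi * log 2 (1 + 0))"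
    by (intro tendsto_intros tendsto_cis) auto
  moreover have "\<forall>\<^sub>F b in sequentially.
      cis (2 * pi * log 2 (1 + real a / real b)) = log_phase (a + b) / log_phase b"
    using eventually_gt_at_top[of 0]
  proof eventually_elim
    case (elim b)
    then have "1 + real a / real b = real (a + b) / real b"
      by (simp add: field_simps)
    then show ?case
      using elim by (simp only: log_phase_def cis_divide) (simp add: log_divide right_diff_distrib)
  qed
  ultimately show ?thesis
    by (simp cong: filterlim_cong add: tendsto_cong)
qed

text \<open>
  The limit \<open>z\<close> along a multiplicative idempotent satisfies \<open>z z = z\<close>. Since \<open>u \<odot>\<^sub>\<beta> u\<close> is
  expressed by iterated quantifiers rather than by a continuous product, this is obtained by
  evaluating at suitable \<open>a\<close>, \<open>b\<close> up to an arbitrary error.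
\<close>

lemma log_phase_tendsto_1:
  assumes u: "u \<in> Nstar" and mult: "u \<odot>\<^sub>\<beta> u = u"
  shows "(log_phase \<longlongrightarrow> 1) (uf_filter u)"
proof -
  have u': "u \<in> betaN" using u by (simp add: Nstar_iff)
  have pos: "\<forall>\<^sub>F a in uf_filter u. a > 0"
    using uf_filter_le_sequentially[OF u] eventually_gt_at_top filter_leD by blast
  have "range log_phase \<subseteq> sphere 0 1"
    by (auto simp: norm_log_phase)
  then obtain z where z: "z \<in> sphere 0 1" "(log_phase \<longlongrightarrow> z) (uf_filter u)"
    using uf_filter_convergent[OF u' compact_sphere] by blast
  have "norm (z * z - z) \<le> 3 * e" if "e > 0" for e
  proof -
    have near: "\<forall>\<^sub>F a in uf_filter u. norm (log_phase a - z) < e"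
      using tendstoD[OF z(2) that] by (simp add: dist_norm)
    then have "\<forall>\<^sub>F a in uf_filter u. \<forall>\<^sub>F b in uf_filter u. norm (log_phase (a * b) - z) < e"
      by (subst (asm) mult[symmetric]) (simp only: eventually_uf_filter_mult[OF u' u'])
    with near pos have
      "\<forall>\<^sub>F a in uf_filter u. \<forall>\<^sub>F b in uf_filter u. norm (z * z - z) \<le> 3 * e"
    proof eventually_elim
      case (elim a)
      note a = elim
      show ?case
        using elim(3) near pos
      proof eventually_elim
        case (elim b)
        let ?x = "log_phase a" and ?y = "log_phase b"
        have "z * z - z = (?x * ?y - z) - ?x * (?y - z) - z * (?x - z)"
          by (simp add: algebra_simps)
        also have "norm \<dots> \<le> norm (?x * ?y - z) + norm (?x * (?y - z)) + norm (z * (?x - z))"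
          by (meson add_mono norm_triangle_ineq4 order.refl order.trans)
        also have "\<dots> = norm (log_phase (a * b) - z) + norm (?y - z) + norm (?x - z)"
          using z(1) a(2) elim(3) by (simp add: norm_mult norm_log_phase log_phase_mult)
        finally show ?case
          using a(1) elim(1,2) by simp
      qed
    qed
    then show ?thesis
      by (simp add: uf_filter_neq_bot[OF u'])
  qed
  then have "norm (z * z - z) \<le> 0 + e" if "e > 0" for e
    using that by (metis add_0 divide_pos_pos zero_less_numeral nonzero_mult_div_cancel_left
        times_divide_eq_right zero_neq_numeral)
  then have "norm (z * z - z) \<le> 0"
    by (rule field_le_epsilon)
  then have "z = 1"
    using z(1) by auto
  with z(2) show ?thesis by simp
qed

text \<open>
  The set \<open>B\<close> in the proof weighs divisibility by powers of 2 against closeness of the phase to 1.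
  Products \<open>a * b\<close> inherit divisibility from the late factor \<open>b\<close> and the phase distance from \<open>a\<close>;
  sums \<open>a + b\<close> do the opposite.
\<close>

lemma add_idempotent_not_mult_idempotent:
  assumes u: "u \<in> Nstar" and add: "u \<oplus>\<^sub>\<beta> u = u"
  shows "u \<odot>\<^sub>\<beta> u \<noteq> u"
proof
  assume mult: "u \<odot>\<^sub>\<beta> u = u"
  have u': "u \<in> betaN" using u by (simp add: Nstar_iff)
  let ?F = "uf_filter u"
  have pos: "\<forall>\<^sub>F a in ?F. a > 0"
    using uf_filter_le_sequentially[OF u] eventually_gt_at_top filter_leD by blast
  note lim = log_phase_tendsto_1[OF u mult]
  define B where "B x \<longleftrightarrow> (\<exists>m. 2 ^ m dvd x \<and> 1 < 2 ^ m * norm (log_phase x - 1))" for x :: nat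
  have "\<forall>\<^sub>F a in ?F. \<forall>\<^sub>F b in ?F. B (a * b)"
    using pos add_idempotent_not_power_of_2[OF u add]
  proof eventually_elim
    case (elim a)
    define d where "d = norm (log_phase a - 1)"
    have d: "d > 0"
      using elim by (simp add: d_def log_phase_eq_1_iff)
    obtain m where m: "1 / (d / 2) < 2 ^ m"
      using real_arch_pow[of 2] by auto
    have "((\<lambda>b. norm (log_phase a * log_phase b - 1)) \<longlongrightarrow> norm (log_phase a * 1 - 1)) ?F"
      by (intro tendsto_intros lim)
    then have "\<forall>\<^sub>F b in ?F. d / 2 < norm (log_phase a * log_phase b - 1)"
      by (rule order_tendstoD(1)) (use d in \<open>simp add: d_def\<close>)
    moreover have "\<forall>\<^sub>F b in ?F. 2 ^ m dvd b"
      by (rule add_idempotent_dvd[OF u' add]) simp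
    ultimately show ?case
      using pos
    proof eventually_elim
      case b: (elim b)
      have "1 < 2 ^ m * (d / 2)"
        using m d by (simp add: field_simps)
      also have "\<dots> < 2 ^ m * norm (log_phase (a * b) - 1)"
        using b elim by (simp add: log_phase_mult)
      finally show ?case
        using b unfolding B_def by (intro exI[of _ m]) simp
    qed
  qed
  then have B: "eventually B ?F"
    using eventually_uf_filter_mult[OF u' u', of B] by (simp add: mult)
  have "\<forall>\<^sub>F a in ?F. \<forall>\<^sub>F b in ?F. \<not> B (a + b)"
    using pos
  proof eventually_elim
    case (elim a)
    have "((\<lambda>b. log_phase (a + b) / log_phase b * log_phase b) \<longlongrightarrow> 1 * 1) ?F"
      by (intro tendsto_mult lim
          filterlim_mono[OF log_phase_add_quotient order.refl uf_filter_le_sequentially[OF u]])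
    moreover have "log_phase b \<noteq> 0" for b
      using norm_log_phase[of b] by auto
    ultimately have "((\<lambda>b. log_phase (a + b)) \<longlongrightarrow> 1) ?F"
      by simp
    then have "\<forall>\<^sub>F b in ?F. dist (log_phase (a + b)) 1 < 1 / 2 ^ a"
      by (rule tendstoD) simp
    moreover have "\<forall>\<^sub>F b in ?F. 2 ^ a dvd b"
      by (rule add_idempotent_dvd[OF u' add]) simp
    ultimately show ?case
    proof eventually_elim
      case b: (elim b)
      have "2 ^ m * norm (log_phase (a + b) - 1) \<le> 1" if "2 ^ m dvd a + b" for m
      proof -
        \<comment> \<open>The crude bound \<open>a < 2 ^ a\<close> replaces the exact power of 2 dividing \<open>a\<close>.\<close>
        have "\<not> a \<le> m"
        proof
          assume "a \<le> m"
          then have "2 ^ a dvd a + b"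
            using that by (meson dvd_trans le_imp_power_dvd)
          then have "2 ^ a dvd a"
            using b by (simp add: dvd_add_left_iff)
          then show False
            using elim by (metis dvd_imp_le less_exp linorder_not_less)
        qed
        then have "2 ^ m * norm (log_phase (a + b) - 1) \<le> 2 ^ a * norm (log_phase (a + b) - 1)"
          by (intro mult_right_mono power_increasing) auto
        also have "\<dots> \<le> 1"
          using b by (simp add: dist_norm field_simps)
        finally show ?thesis .
      qed
      then show ?case
        by (force simp: B_def)
    qed
  qed
  then have "eventually (\<lambda>x. \<not> B x) ?F"
    using eventually_uf_filter_add[OF u' u', of "\<lambda>x. \<not> B x"] by (simp add: add)
  with B show False
    by (simp add: eventually_uf_filter_not[OF u'])
qed

section \<open>Compactness of the space of ultrafilters\<close>

text \<open>
  The ultrafilter lemma. In the order of filters finer is smaller, so Zorn's lemma is applied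
  downwards: a minimal proper filter below \<open>F\<close> decides every set \<open>S\<close>, because it equals its
  infimum with \<open>principal S\<close> unless that infimum is trivial.
\<close>

lemma filter_extends_to_ultrafilter:
  assumes "F \<noteq> bot"
  obtains u where "u \<in> betaN" "\<And>P. eventually P F \<Longrightarrow> {n. P n} \<in> u"
proof -
  have "\<exists>G\<in>{G. G \<noteq> bot \<and> G \<le> F}. \<forall>H\<in>{G. G \<noteq> bot \<and> G \<le> F}. H \<le> G \<longrightarrow> H = G"
  proof (rule predicate_Zorn)
    show "partial_order_on {G. G \<noteq> bot \<and> G \<le> F}
        (relation_of (\<lambda>G H. H \<le> G) {G. G \<noteq> bot \<and> G \<le> F})"
      by (rule partial_order_on_relation_ofI) auto
  next
    fix C assume C: "C \<in> Chains (relation_of (\<lambda>G H. H \<le> G) {G. G \<noteq> bot \<and> G \<le> F})"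
    then have sub: "C \<subseteq> {G. G \<noteq> bot \<and> G \<le> F}"
      and chain: "\<And>G H. G \<in> C \<Longrightarrow> H \<in> C \<Longrightarrow> G \<le> H \<or> H \<le> G"
      by (auto simp: Chains_def relation_of_def)
    show "\<exists>G\<in>{G. G \<noteq> bot \<and> G \<le> F}. \<forall>H\<in>C. G \<le> H"
    proof (cases "C = {}")
      case True
      then show ?thesis using assms by auto
    next
      case False
      have "eventually P (Inf C) \<longleftrightarrow> (\<exists>G\<in>C. eventually P G)" for P
        by (rule eventually_Inf_base[OF False]) (metis chain inf.orderE inf_commute order.refl)
      then have "Inf C \<noteq> bot"
        using sub by (auto simp: trivial_limit_def)
      moreover have "Inf C \<le> F"
        using False sub by (metis (no_types, lifting) Inf_lower2 ex_in_conv mem_Collect_eq subsetD)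
      ultimately show ?thesis
        by (auto intro: Inf_lower)
    qed
  qed
  then obtain G where G: "G \<noteq> bot" "G \<le> F"
    and min: "\<And>H. H \<noteq> bot \<Longrightarrow> H \<le> G \<Longrightarrow> H = G"
    by (auto intro: order.trans)
  define u where "u = {S. eventually (\<lambda>n. n \<in> S) G}"
  have "S \<in> u \<or> - S \<in> u" for S
  proof (cases "inf G (principal S) = bot")
    case True
    then show ?thesis
      by (auto simp: u_def trivial_limit_def eventually_inf_principal elim: eventually_mono)
  next
    case False
    then have "inf G (principal S) = G"
      by (intro min) auto
    then have "G \<le> principal S"
      by (metis inf.cobounded2)
    then show ?thesis
      by (simp add: u_def le_principal)
  qed
  moreover have "{} \<notin> u"
    using G(1) by (simp add: u_def trivial_limit_def)
  ultimately have "u \<in> betaN"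
    by (auto simp: betaN_def ultrafilter_on_nat_def u_def elim: eventually_mono eventually_elim2)
  moreover have "{n. P n} \<in> u" if "eventually P F" for P
    using filter_leD[OF G(2) that] by (simp add: u_def)
  ultimately show thesis by (rule that)
qed

lemma openin_basic_open: "openin betaN_topology (basic_open S)"
  unfolding betaN_topology_def by (intro topology_generated_by_Basis) auto

lemma openin_betaN_basic:
  assumes "openin betaN_topology W" "u \<in> W"
  obtains S where "S \<in> u" "basic_open S \<subseteq> W"
proof -
  have "generate_topology_on (range basic_open) W"
    using assms(1) by (simp add: betaN_topology_def openin_topology_generated_by_iff)
  then have "u \<in> W \<longrightarrow> (\<exists>S. u \<in> basic_open S \<and> basic_open S \<subseteq> W)"
  proof induction
    case (Int V W)
    then show ?case
      by (metis IntE Int_mono basic_open_Int IntI)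
  next
    case (UN K)
    then show ?case by blast
  qed auto
  with assms(2) show thesis
    using that by (auto simp: basic_open_def)
qed

lemma Hausdorff_betaN: "Hausdorff_space betaN_topology"
  unfolding Hausdorff_space_def topspace_betaN
proof (intro allI impI, elim conjE)
  fix u v assume uv: "u \<in> betaN" "v \<in> betaN" "u \<noteq> v"
  have "\<exists>S. S \<in> u \<and> S \<notin> v"
  proof (rule ccontr)
    assume "\<not> ?thesis"
    then have "u \<subseteq> v" by blast
    moreover have "v \<subseteq> u"
      using calculation uv(1,2) by (auto simp: betaN_def) (metis subsetD ultrafilterD(5))
    ultimately show False using uv(3) by blast
  qed
  then obtain S where "S \<in> u" "S \<notin> v" by blast
  then have "u \<in> basic_open S" "v \<in> basic_open (- S)" "disjnt (basic_open S) (basic_open (- S))"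
    using uv by (auto simp: basic_open_def betaN_def ultrafilterD(5) disjnt_def)
  then show "\<exists>U V. openin betaN_topology U \<and> openin betaN_topology V \<and> u \<in> U \<and> v \<in> V \<and> disjnt U V"
    using openin_basic_open by blast
qed

text \<open>
  For a family of closed sets with the finite intersection property, the sets \<open>S\<close> whose basic open
  set contains a member of the family generate a proper filter: a point of the intersection of
  finitely many members contains the finitely many corresponding \<open>S\<close>. Any ultrafilter extending
  it lies in every member, since the complement of a closed set is a union of basic open sets.
\<close>

lemma compact_betaN: "compact_space betaN_topology"
  unfolding compact_space_fip
proof (intro allI impI, elim conjE)
  fix \<C> assume closed: "\<forall>C\<in>\<C>. closedin betaN_topology C"
    and fip: "\<forall>\<F>. finite \<F> \<and> \<F> \<subseteq> \<C> \<longrightarrow> \<Inter>\<F> \<noteq> {}"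
  define G where "G = {S. \<exists>C\<in>\<C>. C \<subseteq> basic_open S}"
  have "(INF S\<in>X. principal S) \<noteq> bot" if X: "X \<subseteq> G" "finite X" for X
  proof -
    have "\<forall>S\<in>X. \<exists>C. C \<in> \<C> \<and> C \<subseteq> basic_open S"
      using X(1) by (auto simp: G_def)
    then obtain c where c: "\<forall>S\<in>X. c S \<in> \<C> \<and> c S \<subseteq> basic_open S"
      unfolding bchoice_iff by blast
    have "\<Inter>(c ` X) \<noteq> {}"
      using fip X(2) c by (simp add: image_subset_iff)
    show ?thesis
    proof (cases "X = {}")
      case False
      obtain w where "w \<in> \<Inter>(c ` X)"
        using \<open>\<Inter>(c ` X) \<noteq> {}\<close> by blast
      then have w: "w \<in> betaN" "\<And>S. S \<in> X \<Longrightarrow> S \<in> w"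
        using c False by (auto simp: basic_open_def)
      have "\<forall>S\<in>X. \<forall>\<^sub>F n in uf_filter w. n \<in> S"
        using w by (simp add: eventually_uf_filter)
      then have "\<forall>\<^sub>F n in uf_filter w. \<forall>S\<in>X. n \<in> S"
        using X(2) by (intro eventually_ball_finite) auto
      then have "\<exists>n. \<forall>S\<in>X. n \<in> S"
        using uf_filter_neq_bot[OF w(1)] eventually_happens' by blast
      then show ?thesis
        by (simp add: INF_principal_finite X(2) principal_eq_bot_iff) blast
    qed (simp add: trivial_limit_def)
  qed
  then have "(INF S\<in>G. principal S) \<noteq> bot"
    by (rule INF_filter_not_bot)
  then obtain u where u: "u \<in> betaN"
    "\<And>P. eventually P (INF S\<in>G. principal S) \<Longrightarrow> {n. P n} \<in> u"
    using filter_extends_to_ultrafilter by blast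
  have Gu: "S \<in> u" if "S \<in> G" for S
    using u(2)[of "\<lambda>n. n \<in> S"] that
    by (simp add: eventually_INF1 eventually_principal)
  have "u \<in> C" if C: "C \<in> \<C>" for C
  proof (rule ccontr)
    assume "u \<notin> C"
    moreover have "openin betaN_topology (betaN - C)"
      using closed C by (metis closedin_def topspace_betaN)
    ultimately obtain S where S: "S \<in> u" "basic_open S \<subseteq> betaN - C"
      using openin_betaN_basic[of "betaN - C" u] u(1) by blast
    have "C \<subseteq> betaN"
      using closed C closedin_subset topspace_betaN by metis
    with S(2) have "C \<subseteq> basic_open (- S)"
      unfolding basic_open_Compl[symmetric] by blast
    with C have "- S \<in> u"
      by (intro Gu) (auto simp: G_def)
    with S(1) show False
      using u(1) by (simp add: betaN_def ultrafilterD(5))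
  qed
  then show "\<Inter>\<C> \<noteq> {}" by blast
qed

lemma closedin_Nstar: "closedin betaN_topology Nstar"
proof -
  have "betaN - Nstar = (\<Union>n. basic_open {n})"
    by (auto simp: Nstar_iff basic_open_def)
  then have "openin betaN_topology (betaN - Nstar)"
    using openin_basic_open by auto
  then show ?thesis
    by (auto simp: closedin_def topspace_betaN Nstar_def)
qed

section \<open>Idempotents from minimality\<close>

lemma minimal_closed_subset:
  assumes X: "compact_space X" and A: "closedin X A" "A \<noteq> {}" "P A"
    and Inter: "\<And>\<C>. \<C> \<noteq> {} \<Longrightarrow> (\<And>C. C \<in> \<C> \<Longrightarrow> P C) \<Longrightarrow> P (\<Inter>\<C>)"
  obtains M where "M \<subseteq> A" "closedin X M" "M \<noteq> {}" "P M"
    "\<And>B. B \<subseteq> M \<Longrightarrow> closedin X B \<Longrightarrow> B \<noteq> {} \<Longrightarrow> P B \<Longrightarrow> B = M"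
proof -
  let ?Z = "{C. C \<subseteq> A \<and> closedin X C \<and> C \<noteq> {} \<and> P C}"
  have "\<exists>M\<in>?Z. \<forall>B\<in>?Z. B \<subseteq> M \<longrightarrow> B = M"
  proof (rule predicate_Zorn)
    show "partial_order_on ?Z (relation_of (\<lambda>C D. D \<subseteq> C) ?Z)"
      by (rule partial_order_on_relation_ofI) auto
  next
    fix \<C> assume C: "\<C> \<in> Chains (relation_of (\<lambda>C D. D \<subseteq> C) ?Z)"
    then have sub: "\<C> \<subseteq> ?Z" and chain: "\<And>C D. C \<in> \<C> \<Longrightarrow> D \<in> \<C> \<Longrightarrow> C \<subseteq> D \<or> D \<subseteq> C"
      by (auto simp: Chains_def relation_of_def)
    show "\<exists>B\<in>?Z. \<forall>C\<in>\<C>. B \<subseteq> C"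
    proof (cases "\<C> = {}")
      case True
      then show ?thesis using A by auto
    next
      case False
      have fip: "\<Inter>\<F> \<noteq> {}" if "finite \<F>" "\<F> \<subseteq> \<C>" for \<F>
      proof (cases "\<F> = {}")
        case False
        have "subset.chain \<C> \<F>"
          using that(2) chain by (auto simp: subset.chain_def)
        with that(1) False have "\<Inter>\<F> \<in> \<F>"
          by (rule Inter_in_chain)
        then show ?thesis using that(2) sub by auto
      qed simp
      have "\<forall>C\<in>\<C>. closedin X C"
        using sub by auto
      with fip have "\<Inter>\<C> \<noteq> {}"
        using X[unfolded compact_space_fip, rule_format, of \<C>] by simp
      moreover have "closedin X (\<Inter>\<C>)"
        using False sub by (intro closedin_Inter) auto
      moreover have "P (\<Inter>\<C>)"
        using False sub by (intro Inter) auto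
      moreover have "\<Inter>\<C> \<subseteq> A"
        using False sub by blast
      ultimately show ?thesis by blast
    qed
  qed
  then obtain M where M: "M \<in> ?Z" and min: "\<forall>B\<in>?Z. B \<subseteq> M \<longrightarrow> B = M"
    by blast
  show thesis
  proof (rule that)
    show "M \<subseteq> A" "closedin X M" "M \<noteq> {}" "P M"
      using M by auto
    show "B = M" if "B \<subseteq> M" "closedin X B" "B \<noteq> {}" "P B" for B
      using min M that by auto
  qed
qed

text \<open>
  The core of the Ellis argument, for an arbitrary condition \<open>P\<close> on sets: minimality
  applied to the image gives \<open>h ` M = M\<close>, so the fibre over \<open>u\<close> is nonempty, and minimality
  applied to the fibre shows that it contains \<open>u\<close>. It is used with \<open>h\<close> a translation by \<open>u\<close>,
  once with \<open>P\<close> closure under \<open>+\<close> and once with \<open>P\<close> closure under both operations.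
\<close>

lemma minimal_closed_imp_fixpoint:
  assumes X: "compact_space X" "Hausdorff_space X"
    and cont: "continuous_map X X h"
    and M: "closedin X M" "u \<in> M"
    and min: "\<And>B. B \<subseteq> M \<Longrightarrow> closedin X B \<Longrightarrow> B \<noteq> {} \<Longrightarrow> P B \<Longrightarrow> B = M"
    and image: "h ` M \<subseteq> M" "P (h ` M)"
    and fibre: "P {v \<in> M. h v = u}"
  shows "h u = u"
proof -
  have "closedin X (h ` M)"
    using continuous_imp_closed_map[OF cont X] M(1) by (simp add: closed_map_def)
  then have "h ` M = M"
    using M(2) image by (intro min) auto
  then obtain v where v: "v \<in> M" "h v = u"
    using M(2) by (metis imageE)
  have "closedin X {u}"
    using M X(2) by (meson closedin_Hausdorff_sing_eq closedin_subset subsetD)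
  then have "closedin X {v \<in> topspace X. h v \<in> {u}}"
    using cont closedin_continuous_map_preimage by blast
  then have "closedin X (M \<inter> {v \<in> topspace X. h v \<in> {u}})"
    using M(1) by (rule closedin_Int[rotated])
  moreover have "M \<inter> {v \<in> topspace X. h v \<in> {u}} = {v \<in> M. h v = u}"
    using closedin_subset[OF M(1)] by auto
  ultimately have "{v \<in> M. h v = u} = M"
    using v fibre by (intro min) auto
  with M(2) show ?thesis by blast
qed

lemma uf_add_assoc: "(u \<oplus>\<^sub>\<beta> v) \<oplus>\<^sub>\<beta> w = u \<oplus>\<^sub>\<beta> (v \<oplus>\<^sub>\<beta> w)"
  by (simp add: uf_add_def add.assoc)

lemma uf_mult_assoc: "(u \<odot>\<^sub>\<beta> v) \<odot>\<^sub>\<beta> w = u \<odot>\<^sub>\<beta> (v \<odot>\<^sub>\<beta> w)"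
  by (simp add: uf_mult_def mult.assoc)

lemma add_idempotent_exists:
  assumes A: "closedin betaN_topology A" "A \<noteq> {}"
    and add: "\<And>u v. u \<in> A \<Longrightarrow> v \<in> A \<Longrightarrow> u \<oplus>\<^sub>\<beta> v \<in> A"
  obtains u where "u \<in> A" "u \<oplus>\<^sub>\<beta> u = u"
proof -
  define P where "P C \<longleftrightarrow> (\<forall>u\<in>C. \<forall>v\<in>C. u \<oplus>\<^sub>\<beta> v \<in> C)" for C
  obtain M where M: "M \<subseteq> A" "closedin betaN_topology M" "M \<noteq> {}" "P M"
    and min: "\<And>B. B \<subseteq> M \<Longrightarrow> closedin betaN_topology B \<Longrightarrow> B \<noteq> {} \<Longrightarrow> P B \<Longrightarrow> B = M"
    by (rule minimal_closed_subset[OF compact_betaN A, of P]) (use add in \<open>auto simp: P_def\<close>)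
  obtain u where u: "u \<in> M"
    using M(3) by blast
  then have "u \<in> betaN"
    using closedin_subset[OF M(2)] by (auto simp: topspace_betaN)
  have "u \<oplus>\<^sub>\<beta> u = u"
  proof (rule minimal_closed_imp_fixpoint[where P = P, OF compact_betaN Hausdorff_betaN
        continuous_uf_ops(1)[OF \<open>u \<in> betaN\<close>] M(2) u min])
    show "(\<oplus>\<^sub>\<beta>) u ` M \<subseteq> M"
      using M(4) u by (auto simp: P_def)
    then show "P ((\<oplus>\<^sub>\<beta>) u ` M)"
      using M(4) by (auto simp: P_def uf_add_assoc image_subset_iff)
    show "P {v \<in> M. u \<oplus>\<^sub>\<beta> v = u}"
      using M(4) by (auto simp: P_def simp flip: uf_add_assoc)
  qed
  with u M(1) that show thesis by blast
qed

text \<open>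
  Left distributivity enters twice: it makes the image of \<open>M\<close> under \<open>v \<mapsto> u \<odot>\<^sub>\<beta> v\<close> closed
  under addition, and, as \<open>u\<close> is an additive idempotent, also the fibre of this map over \<open>u\<close>.
\<close>

lemma common_idempotent_exists:
  assumes A: "closedin betaN_topology A" "A \<noteq> {}"
    and add: "\<And>u v. u \<in> A \<Longrightarrow> v \<in> A \<Longrightarrow> u \<oplus>\<^sub>\<beta> v \<in> A"
    and mult: "\<And>u v. u \<in> A \<Longrightarrow> v \<in> A \<Longrightarrow> u \<odot>\<^sub>\<beta> v \<in> A"
    and distrib: "\<And>u v w. u \<in> A \<Longrightarrow> v \<in> A \<Longrightarrow> w \<in> A \<Longrightarrow>
      u \<odot>\<^sub>\<beta> (v \<oplus>\<^sub>\<beta> w) = (u \<odot>\<^sub>\<beta> v) \<oplus>\<^sub>\<beta> (u \<odot>\<^sub>\<beta> w)"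
  obtains u where "u \<in> A" "u \<oplus>\<^sub>\<beta> u = u" "u \<odot>\<^sub>\<beta> u = u"
proof -
  define P where "P C \<longleftrightarrow> (\<forall>u\<in>C. \<forall>v\<in>C. u \<oplus>\<^sub>\<beta> v \<in> C \<and> u \<odot>\<^sub>\<beta> v \<in> C)" for C
  obtain M where M: "M \<subseteq> A" "closedin betaN_topology M" "M \<noteq> {}" "P M"
    and min: "\<And>B. B \<subseteq> M \<Longrightarrow> closedin betaN_topology B \<Longrightarrow> B \<noteq> {} \<Longrightarrow> P B \<Longrightarrow> B = M"
    by (rule minimal_closed_subset[OF compact_betaN A, of P])
      (use add mult in \<open>auto simp: P_def\<close>)
  obtain u where u: "u \<in> M" "u \<oplus>\<^sub>\<beta> u = u"
    by (rule add_idempotent_exists[OF M(2,3)]) (use M(4) in \<open>auto simp: P_def\<close>)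
  then have "u \<in> betaN"
    using closedin_subset[OF M(2)] by (auto simp: topspace_betaN)
  have distribM: "u \<odot>\<^sub>\<beta> (v \<oplus>\<^sub>\<beta> w) = (u \<odot>\<^sub>\<beta> v) \<oplus>\<^sub>\<beta> (u \<odot>\<^sub>\<beta> w)" if "v \<in> M" "w \<in> M" for v w
    using distrib that u(1) M(1) by blast
  have "u \<odot>\<^sub>\<beta> u = u"
  proof (rule minimal_closed_imp_fixpoint[where P = P, OF compact_betaN Hausdorff_betaN
        continuous_uf_ops(2)[OF \<open>u \<in> betaN\<close>] M(2) u(1) min])
    show uM: "(\<odot>\<^sub>\<beta>) u ` M \<subseteq> M"
      using M(4) u by (auto simp: P_def)
    show "P ((\<odot>\<^sub>\<beta>) u ` M)"
      using M(4) uM by (auto simp: P_def uf_mult_assoc image_subset_iff simp flip: distribM)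
    show "P {v \<in> M. u \<odot>\<^sub>\<beta> v = u}"
      using M(4) u(2) by (auto simp: P_def distribM simp flip: uf_mult_assoc)
  qed
  with u M(1) that show thesis by blast
qed

theorem mainTheorem3:
  fixes A :: "nat set set set"
  assumes "A \<subseteq> Nstar"
    and "A \<noteq> {}"
    and "closedin Nstar_topology A"
    and "\<And>u v. u \<in> A \<Longrightarrow> v \<in> A \<Longrightarrow> u \<oplus>\<^sub>\<beta> v \<in> A"
    and "\<And>u v. u \<in> A \<Longrightarrow> v \<in> A \<Longrightarrow> u \<odot>\<^sub>\<beta> v \<in> A"
  shows "\<exists>u\<in>A. \<exists>v\<in>A. \<exists>w\<in>A. u \<odot>\<^sub>\<beta> (v \<oplus>\<^sub>\<beta> w) \<noteq> (u \<odot>\<^sub>\<beta> v) \<oplus>\<^sub>\<beta> (u \<odot>\<^sub>\<beta> w)"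
proof (rule ccontr)
  assume "\<not> ?thesis"
  then have distrib: "u \<odot>\<^sub>\<beta> (v \<oplus>\<^sub>\<beta> w) = (u \<odot>\<^sub>\<beta> v) \<oplus>\<^sub>\<beta> (u \<odot>\<^sub>\<beta> w)"
    if "u \<in> A" "v \<in> A" "w \<in> A" for u v w
    using that by blast
  have "closedin betaN_topology A"
    using assms(3) closedin_Nstar unfolding Nstar_topology_def by (rule closedin_trans_full)
  then obtain u where "u \<in> A" "u \<oplus>\<^sub>\<beta> u = u" "u \<odot>\<^sub>\<beta> u = u"
    using common_idempotent_exists[OF _ assms(2,4,5) distrib] by blast
  then show False
    using add_idempotent_not_mult_idempotent assms(1) by blast
qed

end
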